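(* Let $c_1'>4$ and $c_2'>0$ be constants. There is a constant $c>0$ such that if $p=p(n)$ satisfies $c_1'\frac{\log n}{n}\le p\le e^{-c_2'/n}$ and $G\in\mathcal{G}_B(2n,p)$, then with probability tending to $1$ as $n\to\infty$, $\mathrm{box}(G)\ge c\,\frac{np}{\log n}$; i.e., almost surely $\mathrm{box}(G)=\Omega\!\left(\frac{np}{\log n}\right)$.
   Context: $\mathcal{G}_B(2n,p)$ is the random balanced bipartite graph with fixed parts $A,B$, $|A|=|B|=n$, in which each of the $n^2$ pairs $\{a,b\}$, $a\in A$, $b\in B$, is an edge independently with probability $p$. The boxicity $\mathrm{box}(G)$ is the minimum $k$ such that there are interval graphs $I_1,\dots,I_k$ on $V(G)$ with $E(G)=E(I_1)\cap\cdots\cap E(I_k)$. $\log$ is the natural logarithm. *)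

theory Defs
  imports "HOL-Probability.Probability" "HOL-Probability.Product_PMF"
begin

text \<open>
  A simple graph is given by a vertex set \<open>V\<close> and a set \<open>E\<close> of two-element subsets of \<open>V\<close>.
\<close>

definition all_edges :: "'a set \<Rightarrow> 'a set set" where
  "all_edges V = {{u, v} | u v. u \<in> V \<and> v \<in> V \<and> u \<noteq> v}"

definition interval_graph :: "'a set \<Rightarrow> 'a set set \<Rightarrow> bool" where
  "interval_graph V E \<longleftrightarrow>
     (\<exists>l r :: 'a \<Rightarrow> real.
        (\<forall>v\<in>V. l v \<le> r v) \<and>
        E = {{u, v} | u v. u \<in> V \<and> v \<in> V \<and> u \<noteq> v \<and> {l u..r u} \<inter> {l v..r v} \<noteq> {}})"

text \<open>
  The intersection of the empty family (\<open>k = 0\<close>) is the complete graph on \<open>V\<close>, so complete graphs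
  have boxicity 0.
\<close>

definition interval_representable :: "'a set \<Rightarrow> 'a set set \<Rightarrow> nat \<Rightarrow> bool" where
  "interval_representable V E k \<longleftrightarrow>
     (\<exists>I :: nat \<Rightarrow> 'a set set.
        (\<forall>i<k. interval_graph V (I i)) \<and> E = all_edges V \<inter> (\<Inter>i<k. I i))"

definition boxicity :: "'a set \<Rightarrow> 'a set set \<Rightarrow> nat" where
  "boxicity V E = (LEAST k. interval_representable V E k)"

text \<open>
  The minimum is attained for every finite simple graph: for each non-edge \<open>{x, y}\<close>, the complete
  graph with that single edge removed is an interval graph.
\<close>

lemma interval_graph_all_but_one:
  assumes "x \<noteq> y"
  shows "interval_graph V (all_edges V - {{x, y}})"
proof -
  define l r :: "'a \<Rightarrow> real"
    where "l v = (if v = y then 1 else 0)" and "r v = (if v = x then 0 else 1)" for v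
  have le: "\<forall>v\<in>V. l v \<le> r v"
    using assms by (simp add: l_def r_def)
  have meet: "{l u..r u} \<inter> {l v..r v} \<noteq> {} \<longleftrightarrow> {u, v} \<noteq> {x, y}" if "u \<noteq> v" for u v
    using assms that unfolding Int_atLeastAtMost atLeastatMost_empty_iff l_def r_def doubleton_eq_iff
    by (cases "u = x"; cases "u = y"; cases "v = x"; cases "v = y"; simp)
  have "all_edges V - {{x, y}} =
      {{u, v} | u v. u \<in> V \<and> v \<in> V \<and> u \<noteq> v \<and> {u, v} \<noteq> {x, y}}"
    unfolding all_edges_def by blast
  also have "\<dots> =
      {{u, v} | u v. u \<in> V \<and> v \<in> V \<and> u \<noteq> v \<and> {l u..r u} \<inter> {l v..r v} \<noteq> {}}"
    by (intro Collect_cong iff_exI conj_cong refl) (rule meet[symmetric])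
  finally show ?thesis
    using le unfolding interval_graph_def by blast
qed

lemma interval_representable_boxicity:
  assumes "finite V" and "E \<subseteq> all_edges V"
  shows "interval_representable V E (boxicity V E)"
proof -
  have "all_edges V \<subseteq> Pow V"
    by (auto simp: all_edges_def)
  then have "finite (all_edges V - E)"
    using assms(1) by (meson finite_Diff finite_Pow_iff finite_subset)
  then obtain f and k :: nat where f: "all_edges V - E = f ` {i. i < k}"
    using finite_imp_nat_seg_image_inj_on by metis
  have "interval_graph V (all_edges V - {f i})" if "i < k" for i
  proof -
    have "f i \<in> all_edges V"
      using f that by blast
    then obtain x y where "f i = {x, y}" "x \<noteq> y"
      by (auto simp: all_edges_def)
    then show ?thesis
      using interval_graph_all_but_one by metis
  qed
  moreover have "E = all_edges V \<inter> (\<Inter>i<k. all_edges V - {f i})"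
    using assms(2) f by auto
  ultimately have "interval_representable V E k"
    unfolding interval_representable_def by (intro exI[of _ "\<lambda>i. all_edges V - {f i}"]) auto
  then show ?thesis
    unfolding boxicity_def by (rule LeastI)
qed

text \<open>
  The parts are \<open>A = Inl ` {..<n}\<close> and \<open>B = Inr ` {..<n}\<close>. The graph is sampled by tossing an
  independent coin for each pair in \<open>{..<n} \<times> {..<n}\<close>; only \<open>0 \<le> p \<le> 1\<close> is meaningful, since
  \<open>bernoulli_pmf\<close> clips its parameter to that range.
\<close>

definition bipartite_verts :: "nat \<Rightarrow> (nat + nat) set" where
  "bipartite_verts n = {..<n} <+> {..<n}"

definition random_bipartite :: "nat \<Rightarrow> real \<Rightarrow> (nat + nat) set set pmf" where
  "random_bipartite n p =
     map_pmf (\<lambda>\<omega>. {{Inl a, Inr b} | a b. a < n \<and> b < n \<and> \<omega> (a, b)})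
       (Pi_pmf ({..<n} \<times> {..<n}) False (\<lambda>_. bernoulli_pmf p))"

end

theory Submission imports Defs "HOL-Real_Asymp.Real_Asymp" begin

text \<open>
  Choose \<open>s\<close> of order \<open>ln n / p\<close> such that almost surely every \<open>s\<close> vertices of \<open>A\<close> and \<open>s\<close>
  vertices of \<open>B\<close> span an edge. In an interval supergraph of \<open>G\<close>, delete the \<open>s\<close> vertices of \<open>A\<close>
  with the smallest right endpoints and the vertices of \<open>B\<close> to the right of all of them, of which
  there are fewer than \<open>s\<close>: then no vertex of \<open>A\<close> is to the left of a vertex of \<open>B\<close> any more. Doing
  the same for the opposite order, all non-edges between the parts are covered by \<open>2 * s\<close> vertices
  on each side. If \<open>k\<close> interval graphs represent \<open>G\<close>, then deleting \<open>2 * s * k\<close> vertices on each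
  side leaves a complete bipartite graph. Since almost surely every vertex cover of the non-edges
  between the parts is of linear size, \<open>k\<close> is at least of order \<open>n / s\<close>.
\<close>

section \<open>Covering the non-edges between two vertex sets of an interval graph\<close>

lemma ex_initial_subset:
  fixes f :: "'a \<Rightarrow> real"
  assumes "finite A" "s \<le> card A"
  shows "\<exists>S\<subseteq>A. card S = s \<and> (\<forall>x\<in>S. \<forall>y\<in>A - S. f x \<le> f y)"
  using assms(2)
proof (induction s)
  case 0
  show ?case by (intro exI[of _ "{}"]) auto
next
  case (Suc s)
  then obtain S where S: "S \<subseteq> A" "card S = s" "\<forall>x\<in>S. \<forall>y\<in>A - S. f x \<le> f y"
    by auto
  have fin: "finite S" "finite (A - S)"
    using S(1) assms(1) finite_subset by auto
  have "A - S \<noteq> {}"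
    using S Suc.prems card_mono[OF fin(1), of A] by auto
  then obtain z where z: "z \<in> A - S" "\<forall>y\<in>A - S. f z \<le> f y"
    using ex_min_if_finite[of "f ` (A - S)"] fin(2) by (fastforce simp: not_less)
  show ?case
    using S z fin by (intro exI[of _ "insert z S"]) auto
qed

text \<open>This handles one order of the intervals: with \<open>f\<close> the right endpoints on
  \<open>A\<close> and \<open>g\<close> the left endpoints on \<open>B\<close>,
  \<open>g b \<le> f a\<close> fails exactly when \<open>a\<close> lies wholly to the left of
  \<open>b\<close>. An element outside \<open>B'\<close> has its \<open>g\<close> at most some value
  of \<open>f\<close> on \<open>A'\<close>, and these are the smallest values of
  \<open>f\<close>.\<close>

lemma threshold_cover:
  fixes f :: "'a \<Rightarrow> real" and g :: "'b \<Rightarrow> real"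
  assumes fin: "finite A" "finite B"
    and meet: "\<And>S T. S \<subseteq> A \<Longrightarrow> T \<subseteq> B \<Longrightarrow> card S = s \<Longrightarrow> card T = s \<Longrightarrow>
      \<exists>a\<in>S. \<exists>b\<in>T. g b \<le> f a"
  obtains A' B' where "A' \<subseteq> A" "B' \<subseteq> B" "card A' \<le> s" "card B' \<le> s"
    "\<And>a b. a \<in> A - A' \<Longrightarrow> b \<in> B - B' \<Longrightarrow> g b \<le> f a"
proof (cases "s \<le> card A")
  case False
  \<comment> \<open>\<open>A\<close> has fewer than \<open>s\<close> elements and is deleted
    entirely, so the last condition is vacuous.\<close>
  then show ?thesis
    by (intro that[of A "{}"]) auto
next
  case True
  then obtain A' where A': "A' \<subseteq> A" "card A' = s" "\<forall>x\<in>A'. \<forall>y\<in>A - A'. f x \<le> f y"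
    using ex_initial_subset[OF fin(1)] by blast
  define B' where "B' = {b\<in>B. \<forall>a\<in>A'. f a < g b}"
  have "card B' < s"
  proof (rule ccontr)
    assume "\<not> card B' < s"
    then obtain T where T: "T \<subseteq> B'" "card T = s"
      by (metis not_less obtain_subset_with_card_n)
    then show False
      using meet[of A' T] A' unfolding B'_def by fastforce
  qed
  then show ?thesis
    using A' by (intro that[of A' B']) (auto simp: B'_def not_less, meson DiffI order_trans)
qed

text \<open>Two disjoint intervals are ordered one way or the other, so one use of
  \<open>threshold_cover\<close> per order suffices, each deleting at most \<open>s\<close> vertices
  per side.\<close>

lemma interval_graph_nonedge_cover:
  assumes J: "interval_graph V J" and fin: "finite A" "finite B"
    and sub: "A \<subseteq> V" "B \<subseteq> V" "A \<inter> B = {}"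
    and meet: "\<And>S T. S \<subseteq> A \<Longrightarrow> T \<subseteq> B \<Longrightarrow> card S = s \<Longrightarrow> card T = s \<Longrightarrow>
      \<exists>a\<in>S. \<exists>b\<in>T. {a, b} \<in> J"
  obtains A' B' where "A' \<subseteq> A" "B' \<subseteq> B" "card A' \<le> 2 * s" "card B' \<le> 2 * s"
    "\<And>a b. a \<in> A - A' \<Longrightarrow> b \<in> B - B' \<Longrightarrow> {a, b} \<in> J"
proof -
  obtain l r :: "'a \<Rightarrow> real" where lr: "\<forall>v\<in>V. l v \<le> r v"
    and J_eq: "J = {{u, v} | u v. u \<in> V \<and> v \<in> V \<and> u \<noteq> v \<and> {l u..r u} \<inter> {l v..r v} \<noteq> {}}"
    using J unfolding interval_graph_def by blast
  have J_iff: "{a, b} \<in> J \<longleftrightarrow> l b \<le> r a \<and> l a \<le> r b" if "a \<in> A" "b \<in> B" for a b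
  proof -
    have ab: "a \<in> V" "b \<in> V" "a \<noteq> b"
      using that sub by auto
    then have "{a, b} \<in> J \<longleftrightarrow> {l a..r a} \<inter> {l b..r b} \<noteq> {}"
      unfolding J_eq by (auto simp: doubleton_eq_iff)
    \<comment> \<open>Both intervals are nonempty by \<open>lr\<close>, so they meet unless one ends
      before the other begins.\<close>
    also have "\<dots> \<longleftrightarrow> l b \<le> r a \<and> l a \<le> r b"
      using lr ab by auto
    finally show ?thesis .
  qed
  have "\<exists>a\<in>S. \<exists>b\<in>T. l b \<le> r a" "\<exists>a\<in>S. \<exists>b\<in>T. - r b \<le> - l a"
    if ST: "S \<subseteq> A" "T \<subseteq> B" "card S = s" "card T = s" for S T
    using meet[OF ST] J_iff ST by (auto, meson in_mono, meson in_mono)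
  note meets = this
  obtain A1 B1 where 1: "A1 \<subseteq> A" "B1 \<subseteq> B" "card A1 \<le> s" "card B1 \<le> s"
    "\<And>a b. a \<in> A - A1 \<Longrightarrow> b \<in> B - B1 \<Longrightarrow> l b \<le> r a"
    by (rule threshold_cover[OF fin, where f = r and g = l and s = s], erule (3) meets(1)) blast
  \<comment> \<open>Negating the endpoints reduces the opposite order, \<open>b\<close> to the left
    of \<open>a\<close>, to the first one.\<close>
  obtain A2 B2 where 2: "A2 \<subseteq> A" "B2 \<subseteq> B" "card A2 \<le> s" "card B2 \<le> s"
    "\<And>a b. a \<in> A - A2 \<Longrightarrow> b \<in> B - B2 \<Longrightarrow> - r b \<le> - l a"
    by (rule threshold_cover[OF fin, where f = "\<lambda>a. - l a" and g = "\<lambda>b. - r b" and s = s],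
        erule (3) meets(2)) blast
  show ?thesis
  proof (rule that[of "A1 \<union> A2" "B1 \<union> B2"])
    show "card (A1 \<union> A2) \<le> 2 * s" "card (B1 \<union> B2) \<le> 2 * s"
      using card_Un_le[of A1 A2] card_Un_le[of B1 B2] 1 2 by linarith+
    show "{a, b} \<in> J" if "a \<in> A - (A1 \<union> A2)" "b \<in> B - (B1 \<union> B2)" for a b
      using that J_iff 1(5)[of a b] 2(5)[of a b] by auto
  qed (use 1 2 in auto)
qed

text \<open>Each graph \<open>I i\<close> contains \<open>E\<close>, so \<open>no_empty\<close>
  passes to it and \<open>2 * s\<close> vertices per side cover its non-edges between
  \<open>A\<close> and \<open>B\<close>. If \<open>k * (2 * s) \<le> t\<close>, at least
  \<open>n - t\<close> vertices per side avoid all these covers; across the parts they are adjacent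
  in every \<open>I i\<close>, hence in \<open>E\<close>, against
  \<open>no_complete\<close>.\<close>

lemma boxicity_lower_bound:
  assumes V: "finite V" "E \<subseteq> all_edges V"
    and sub: "A \<subseteq> V" "B \<subseteq> V" "A \<inter> B = {}" and card: "card A = n" "card B = n"
    and no_empty: "\<And>S T. S \<subseteq> A \<Longrightarrow> T \<subseteq> B \<Longrightarrow> card S = s \<Longrightarrow> card T = s \<Longrightarrow>
      \<exists>a\<in>S. \<exists>b\<in>T. {a, b} \<in> E"
    and no_complete: "\<And>S T. S \<subseteq> A \<Longrightarrow> T \<subseteq> B \<Longrightarrow> card S = n - t \<Longrightarrow> card T = n - t \<Longrightarrow>
      \<exists>a\<in>S. \<exists>b\<in>T. {a, b} \<notin> E"
  shows "t < 2 * s * boxicity V E"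
proof (rule ccontr)
  define k where "k = boxicity V E"
  assume "\<not> t < 2 * s * boxicity V E"
  then have t: "k * (2 * s) \<le> t"
    by (simp add: k_def ac_simps)
  obtain I where I: "\<And>i. i < k \<Longrightarrow> interval_graph V (I i)" "E = all_edges V \<inter> (\<Inter>i<k. I i)"
    using interval_representable_boxicity[OF V] unfolding interval_representable_def k_def by blast
  have fin: "finite A" "finite B"
    using sub V(1) by (auto intro: finite_subset)
  have "\<exists>A' B'. A' \<subseteq> A \<and> B' \<subseteq> B \<and> card A' \<le> 2 * s \<and> card B' \<le> 2 * s \<and>
      (\<forall>a b. a \<in> A - A' \<longrightarrow> b \<in> B - B' \<longrightarrow> {a, b} \<in> I i)" if i: "i < k" for i
  proof -
    have "\<exists>a\<in>S. \<exists>b\<in>T. {a, b} \<in> I i"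
      if "S \<subseteq> A" "T \<subseteq> B" "card S = s" "card T = s" for S T
      using no_empty[OF that] i I(2) by blast
    then show ?thesis
      using interval_graph_nonedge_cover[OF I(1)[OF i] fin sub, of s] by metis
  qed
  then obtain A' B' where "\<forall>i<k. A' i \<subseteq> A \<and> B' i \<subseteq> B \<and> card (A' i) \<le> 2 * s \<and>
      card (B' i) \<le> 2 * s \<and> (\<forall>a b. a \<in> A - A' i \<longrightarrow> b \<in> B - B' i \<longrightarrow> {a, b} \<in> I i)"
    by metis
  then have AB': "\<And>i. i < k \<Longrightarrow> card (A' i) \<le> 2 * s" "\<And>i. i < k \<Longrightarrow> card (B' i) \<le> 2 * s"
    "\<And>i. i < k \<Longrightarrow> A' i \<subseteq> A" "\<And>i. i < k \<Longrightarrow> B' i \<subseteq> B"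
    "\<And>i a b. i < k \<Longrightarrow> a \<in> A - A' i \<Longrightarrow> b \<in> B - B' i \<Longrightarrow> {a, b} \<in> I i"
    by blast+
  have large: "n - t \<le> card (C - (\<Union>i<k. D i))"
    if "finite C" "card C = n" "\<And>i. i < k \<Longrightarrow> card (D i) \<le> 2 * s" "\<And>i. i < k \<Longrightarrow> D i \<subseteq> C"
    for C and D :: "nat \<Rightarrow> 'a set"
  proof -
    have "card (\<Union>i<k. D i) \<le> (\<Sum>i<k. card (D i))"
      by (rule card_UN_le) simp
    also have "\<dots> \<le> k * (2 * s)"
      using sum_bounded_above[of "{..<k}" "\<lambda>i. card (D i)" "2 * s"] that(3) by simp
    finally show ?thesis
      using t that(2) diff_card_le_card_Diff[of "\<Union>i<k. D i" C] that(1,4)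
      by (meson UN_least diff_le_mono2 finite_subset lessThan_iff order_trans)
  qed
  obtain S where S: "S \<subseteq> A - (\<Union>i<k. A' i)" "card S = n - t"
    using large[of A A'] fin card AB' by (metis obtain_subset_with_card_n)
  obtain T where T: "T \<subseteq> B - (\<Union>i<k. B' i)" "card T = n - t"
    using large[of B B'] fin card AB' by (metis obtain_subset_with_card_n)
  obtain a b where ab: "a \<in> S" "b \<in> T" "{a, b} \<notin> E"
    using no_complete[of S T] S T by blast
  have AB: "a \<in> A" "b \<in> B"
    using ab(1,2) S(1) T(1) by auto
  then have "a \<in> V" "b \<in> V" "a \<noteq> b"
    using sub by auto
  then have "{a, b} \<in> all_edges V"
    unfolding all_edges_def by blast
  moreover have "{a, b} \<in> I i" if "i < k" for i
    using that ab(1,2) S(1) T(1) AB by (intro AB'(5)) auto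
  ultimately show False
    using ab(3) I(2) by blast
qed

section \<open>Constant rectangles in a family of independent coin tosses\<close>

lemma prob_Pi_pmf_const_on:
  assumes "finite I" "J \<subseteq> I"
  shows "measure_pmf.prob (Pi_pmf I d (\<lambda>_. q)) {\<omega>. \<forall>x\<in>J. \<omega> x = v} = pmf q v ^ card J"
proof -
  \<comment> \<open>Written as a product set without constraint off \<open>J\<close>, the event has
    a probability that factors over the coordinates.\<close>
  have "{\<omega>. \<forall>x\<in>J. \<omega> x = v} = Pi I (\<lambda>x. if x \<in> J then {v} else UNIV)"
    using assms(2) by (auto simp: Pi_def)
  then have "measure_pmf.prob (Pi_pmf I d (\<lambda>_. q)) {\<omega>. \<forall>x\<in>J. \<omega> x = v} =
      (\<Prod>x\<in>I. measure_pmf.prob q (if x \<in> J then {v} else UNIV))"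
    using assms(1) by (simp add: measure_Pi_pmf_Pi)
  also have "\<dots> = (\<Prod>x\<in>J. pmf q v)"
    using assms by (intro prod.mono_neutral_cong_right) (auto simp: measure_pmf_single)
  finally show ?thesis by simp
qed

text \<open>Union bound over all pairs of \<open>m\<close>-sets. Leaving \<open>v\<close> open
  covers both bad events: \<open>False\<close> for edge-free rectangles, \<open>True\<close> for
  complete ones.\<close>

lemma prob_constant_rectangle_le:
  "measure_pmf.prob (Pi_pmf ({..<n} \<times> {..<n}) d (\<lambda>_. q))
     {\<omega>. \<exists>S T. S \<subseteq> {..<n} \<and> T \<subseteq> {..<n} \<and> card S = m \<and> card T = m \<and> (\<forall>x\<in>S \<times> T. \<omega> x = v)}
   \<le> real (n choose m) ^ 2 * pmf q v ^ (m * m)"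
proof -
  let ?P = "measure_pmf.prob (Pi_pmf ({..<n} \<times> {..<n}) d (\<lambda>_. q))"
  define X where "X = {S. S \<subseteq> {..<n} \<and> card S = m}"
  have X: "finite X" "card X = n choose m"
    unfolding X_def using n_subsets[of "{..<n}" m] by auto
  have "{\<omega>. \<exists>S T. S \<subseteq> {..<n} \<and> T \<subseteq> {..<n} \<and> card S = m \<and> card T = m \<and> (\<forall>x\<in>S \<times> T. \<omega> x = v)}
      = (\<Union>R\<in>X \<times> X. {\<omega>. \<forall>x\<in>fst R \<times> snd R. \<omega> x = v})"
    by (simp only: set_eq_iff X_def UN_iff Bex_def split_paired_Ex mem_Times_iff fst_conv snd_conv
        mem_Collect_eq) blast
  also have "?P \<dots> \<le> (\<Sum>R\<in>X \<times> X. ?P {\<omega>. \<forall>x\<in>fst R \<times> snd R. \<omega> x = v})"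
    using X(1) by (intro measure_pmf.finite_measure_subadditive_finite) auto
  also have "\<dots> = (\<Sum>R\<in>X \<times> X. pmf q v ^ (m * m))"
  proof (intro sum.cong refl)
    fix R assume "R \<in> X \<times> X"
    then have R: "fst R \<times> snd R \<subseteq> {..<n} \<times> {..<n}" "card (fst R \<times> snd R) = m * m"
      by (auto simp: X_def card_cartesian_product)
    then show "?P {\<omega>. \<forall>x\<in>fst R \<times> snd R. \<omega> x = v} = pmf q v ^ (m * m)"
      using prob_Pi_pmf_const_on[OF _ R(1), of d q v] by (simp only: R(2)) simp
  qed
  also have "\<dots> = real (n choose m) ^ 2 * pmf q v ^ (m * m)"
    by (simp add: X(2) card_cartesian_product power2_eq_square)
  finally show ?thesis .
qed

section \<open>Exponential estimates for the two failure probabilities\<close>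

text \<open>A single term of the expansion of \<open>(1 + x) ^ n\<close> is at most the whole sum,
  hence at most \<open>exp (n * x)\<close>. A free \<open>x\<close> allows both parts of the
  exponent to be small multiples of \<open>n\<close> when \<open>t\<close> is one.\<close>

lemma binomial_le_exp:
  fixes x :: real
  assumes "0 < x"
  shows "real (n choose t) \<le> exp (real n * x + real t * ln (1 / x))"
proof (cases "t \<le> n")
  case True
  have "real (n choose t) * x ^ t \<le> (\<Sum>k\<le>n. real (n choose k) * x ^ k)"
    using True assms by (intro member_le_sum) auto
  also have "\<dots> = (1 + x) ^ n"
    using binomial_ring[of x 1 n] by (simp add: add.commute)
  also have "\<dots> \<le> exp x ^ n"
    using assms by (intro power_mono) (auto simp: exp_ge_add_one_self)
  also have "\<dots> = exp (real n * x)"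
    by (simp add: exp_of_nat_mult)
  finally have "real (n choose t) \<le> exp (real n * x) / x ^ t"
    using assms by (simp add: field_simps)
  also have "1 / x ^ t = exp (real t * ln (1 / x))"
    using assms by (simp add: exp_of_nat_mult power_one_over)
  then have "exp (real n * x) / x ^ t = exp (real n * x + real t * ln (1 / x))"
    by (simp add: exp_add divide_inverse)
  finally show ?thesis .
qed (simp add: binomial_eq_0)

text \<open>The number of pairs is at most \<open>exp (2 * s * ln n)\<close>, and each is edge-free
  with probability at most \<open>exp (- 3 * s * ln n)\<close>. The factor 3 beats the 2 and leaves
  \<open>exp (- s * ln n)\<close>, where \<open>s\<close> is at least 1.\<close>

lemma choose_sq_mult_power_le_empty:
  fixes p :: real
  assumes "1 \<le> n" "0 < p" "p \<le> 1" "3 * ln n \<le> p * s" "0 < s"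
  shows "real (n choose s) ^ 2 * (1 - p) ^ (s * s) \<le> 1 / n"
proof -
  have "real (n choose s) ^ 2 \<le> (real n ^ s) ^ 2"
    \<comment> \<open>\<open>s\<close> may exceed \<open>n\<close>; the binomial coefficient is then
      0.\<close>
    by (intro power_mono, cases "s \<le> n") (use binomial_le_pow[of s n] in \<open>auto simp: binomial_eq_0 simp flip: of_nat_power\<close>)
  also have "\<dots> = exp (2 * s * ln n)"
    using assms(1) exp_of_nat_mult[of "2 * s" "ln (real n)"]
    by (simp add: mult.commute flip: power_mult)
  finally have 1: "real (n choose s) ^ 2 \<le> exp (2 * s * ln n)" .
  have "(1 - p) ^ (s * s) \<le> exp (- p) ^ (s * s)"
    using assms exp_ge_add_one_self[of "- p"] by (intro power_mono) auto
  also have "\<dots> = exp (- (p * s) * s)"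
    by (simp add: exp_of_nat_mult[symmetric] algebra_simps)
  finally have "real (n choose s) ^ 2 * (1 - p) ^ (s * s) \<le> exp (2 * s * ln n) * exp (- (p * s) * s)"
    using 1 assms by (intro mult_mono) auto
  also have "\<dots> = exp (s * (2 * ln n - p * s))"
    by (simp add: algebra_simps flip: exp_add)
  also have "\<dots> \<le> exp (s * (- ln n))"
    using assms by (intro iffD2[OF exp_le_cancel_iff] mult_left_mono) auto
  also have "\<dots> \<le> exp (1 * (- ln n))"
    using assms by (intro iffD2[OF exp_le_cancel_iff] mult_right_mono_neg) auto
  also have "\<dots> = 1 / n"
    using assms by (simp add: exp_minus divide_inverse)
  finally show ?thesis .
qed

text \<open>Counting the \<open>t\<close> omitted vertices instead of the \<open>n - t\<close>
  chosen ones bounds the number of pairs by \<open>exp (c / 4 * n)\<close>. Each pair spans at least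
  \<open>n * n / 2\<close> potential edges, all present with probability at most
  \<open>exp (- (c / 2) * n)\<close>.\<close>

lemma choose_sq_mult_power_le_complete:
  fixes p x \<delta> c :: real
  assumes "1 \<le> n" "0 \<le> p" "p \<le> exp (- c / n)" "0 < c"
    and x: "0 < x" "x \<le> c / 16" "x \<le> 1"
    and \<delta>: "\<delta> \<le> 1 / 4" "\<delta> * ln (1 / x) \<le> c / 16" and t: "t \<le> \<delta> * n"
  shows "real (n choose (n - t)) ^ 2 * p ^ ((n - t) * (n - t)) \<le> exp (- (c / 4) * n)"
proof -
  have tn: "t \<le> n"
  proof -
    have "\<delta> * n \<le> 1 * real n"
      using \<delta> by (intro mult_right_mono) auto
    then show ?thesis using t by simp
  qed
  have "real (n choose (n - t)) \<le> exp (real n * x + real t * ln (1 / x))"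
    using binomial_le_exp[OF x(1), of n t] binomial_symmetric[OF tn] by simp
  \<comment> \<open>Each of the two summands in the exponent is at most
    \<open>c / 16 * n\<close>.\<close>
  also have "\<dots> \<le> exp (c / 8 * n)"
  proof -
    have "real t * ln (1 / x) \<le> \<delta> * n * ln (1 / x)"
      using t x by (intro mult_right_mono) auto
    also have "\<dots> = \<delta> * ln (1 / x) * n" by simp
    also have "\<dots> \<le> c / 16 * n"
      using \<delta> by (intro mult_right_mono) auto
    finally have "real t * ln (1 / x) \<le> c / 16 * n" .
    moreover have "real n * x \<le> real n * (c / 16)"
      using x by (intro mult_left_mono) auto
    ultimately show ?thesis by (simp add: mult.commute)
  qed
  finally have "real (n choose (n - t)) ^ 2 \<le> exp (c / 8 * n) ^ 2"
    by (intro power_mono) auto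
  also have "\<dots> = exp (c / 4 * n)"
    by (simp flip: exp_double)
  finally have 1: "real (n choose (n - t)) ^ 2 \<le> exp (c / 4 * n)" .
  have "real n * (3 / 4) \<le> n - t"
    using t \<delta> tn mult_right_mono[of \<delta> "1/4" "real n"] by (simp add: of_nat_diff)
  then have "(real n * (3 / 4)) * (real n * (3 / 4)) \<le> real (n - t) * real (n - t)"
    by (intro mult_mono) auto
  moreover have "real n / 2 * n \<le> (real n * (3 / 4)) * (real n * (3 / 4))"
    using mult_right_mono[of "1 / 2" "9 / 16" "real n * real n"] by simp
  ultimately have sq: "n / 2 * n \<le> real ((n - t) * (n - t))"
    unfolding of_nat_mult by linarith
  have "p ^ ((n - t) * (n - t)) \<le> exp (- c / n) ^ ((n - t) * (n - t))"
    using assms by (intro power_mono) auto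
  also have "\<dots> = exp (real ((n - t) * (n - t)) * (- c / n))"
    by (rule exp_of_nat_mult[symmetric])
  also have "\<dots> \<le> exp (n / 2 * n * (- c / n))"
    using assms sq by (intro iffD2[OF exp_le_cancel_iff] mult_right_mono_neg) auto
  also have "\<dots> = exp (- (c / 2) * n)"
    using assms by simp
  finally have "real (n choose (n - t)) ^ 2 * p ^ ((n - t) * (n - t))
      \<le> exp (c / 4 * n) * exp (- (c / 2) * n)"
    using 1 assms by (intro mult_mono) auto
  also have "\<dots> = exp (- (c / 4) * n)"
    by (simp flip: exp_add)
  finally show ?thesis .
qed

section \<open>Boxicity of the random bipartite graph\<close>

text \<open>Restates \<open>boxicity_lower_bound\<close> in terms of the coin tosses, so that its
  hypotheses exclude exactly the constant rectangles bounded by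
  \<open>prob_constant_rectangle_le\<close>.\<close>

lemma boxicity_bipartite_lower_bound:
  fixes \<omega> :: "nat \<times> nat \<Rightarrow> bool" and n s t :: nat
  defines "E \<equiv> {{Inl a, Inr b} | a b. a < n \<and> b < n \<and> \<omega> (a, b)}"
  assumes no_empty: "\<not> (\<exists>S T. S \<subseteq> {..<n} \<and> T \<subseteq> {..<n} \<and> card S = s \<and> card T = s \<and>
      (\<forall>x\<in>S \<times> T. \<omega> x = False))"
    and no_complete: "\<not> (\<exists>S T. S \<subseteq> {..<n} \<and> T \<subseteq> {..<n} \<and> card S = n - t \<and> card T = n - t \<and>
      (\<forall>x\<in>S \<times> T. \<omega> x = True))"
  shows "t < 2 * s * boxicity (bipartite_verts n) E"
proof (rule boxicity_lower_bound[where A = "Inl ` {..<n}" and B = "Inr ` {..<n}"])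
  have E_iff: "{Inl a, Inr b} \<in> E \<longleftrightarrow> a < n \<and> b < n \<and> \<omega> (a, b)" for a b
    unfolding E_def by (auto simp: doubleton_eq_iff)
  show "finite (bipartite_verts n)"
    by (simp add: bipartite_verts_def)
  show "E \<subseteq> all_edges (bipartite_verts n)"
    unfolding E_def all_edges_def bipartite_verts_def by blast
  have preimage: "\<exists>S' T'. S' \<subseteq> {..<n} \<and> T' \<subseteq> {..<n} \<and> card S' = m \<and> card T' = m \<and>
      S = Inl ` S' \<and> T = Inr ` T'"
    if ST: "S \<subseteq> Inl ` {..<n}" "T \<subseteq> Inr ` {..<n}" "card S = m" "card T = m"
    for S T :: "(nat + nat) set" and m
  proof -
    obtain S' T' where "S' \<subseteq> {..<n}" "S = Inl ` S'" "T' \<subseteq> {..<n}" "T = Inr ` T'"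
      using ST by (auto simp: subset_image_iff)
    then show ?thesis
      using ST by (intro exI[of _ S'] exI[of _ T']) (simp add: card_image)
  qed
  show "\<exists>a\<in>S. \<exists>b\<in>T. {a, b} \<in> E"
    if ST: "S \<subseteq> Inl ` {..<n}" "T \<subseteq> Inr ` {..<n}" "card S = s" "card T = s" for S T
  proof -
    obtain S' T' where *: "S' \<subseteq> {..<n}" "T' \<subseteq> {..<n}" "card S' = s" "card T' = s"
      "S = Inl ` S'" "T = Inr ` T'"
      using preimage[OF ST] by metis
    then have "\<not> (\<forall>x\<in>S' \<times> T'. \<omega> x = False)"
      using no_empty by blast
    then obtain a b where "a \<in> S'" "b \<in> T'" "\<omega> (a, b)"
      by auto
    moreover from this have "{Inl a, Inr b} \<in> E"
      using * by (auto simp: E_iff)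
    ultimately show ?thesis
      using * by blast
  qed
  show "\<exists>a\<in>S. \<exists>b\<in>T. {a, b} \<notin> E"
    if ST: "S \<subseteq> Inl ` {..<n}" "T \<subseteq> Inr ` {..<n}" "card S = n - t" "card T = n - t" for S T
  proof -
    obtain S' T' where *: "S' \<subseteq> {..<n}" "T' \<subseteq> {..<n}" "card S' = n - t" "card T' = n - t"
      "S = Inl ` S'" "T = Inr ` T'"
      using preimage[OF ST] by metis
    then have "\<not> (\<forall>x\<in>S' \<times> T'. \<omega> x = True)"
      using no_complete by blast
    then obtain a b where "a \<in> S'" "b \<in> T'" "\<not> \<omega> (a, b)"
      by auto
    moreover from this have "{Inl a, Inr b} \<notin> E"
      using * by (auto simp: E_iff)
    ultimately show ?thesis
      using * by blast
  qed
qed (auto simp: bipartite_verts_def card_image)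

text \<open>Outside the two bad events \<open>t < 2 * s * k\<close> holds for the boxicity
  \<open>k\<close>. Since \<open>\<delta> * n / 2 \<le> t\<close> and
  \<open>s \<le> 4 * ln n / p\<close>, this gives the factor \<open>\<delta> / 16\<close>.\<close>

lemma prob_boxicity_ge:
  fixes p x \<delta> c :: real
  assumes n: "3 \<le> n" "2 \<le> \<delta> * n" and p: "0 < p" "p \<le> exp (- c / n)" and c: "0 < c"
    and x: "0 < x" "x \<le> c / 16" "x \<le> 1"
    and \<delta>: "0 < \<delta>" "\<delta> \<le> 1 / 4" "\<delta> * ln (1 / x) \<le> c / 16"
  shows "1 - (1 / n + exp (- (c / 4) * n)) \<le> measure_pmf.prob (random_bipartite n p)
    {E. real (boxicity (bipartite_verts n) E) \<ge> \<delta> / 16 * (real n * p / ln n)}"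
proof -
  define s where "s = nat \<lceil>3 * ln n / p\<rceil>"
  define t where "t = nat \<lfloor>\<delta> * n\<rfloor>"
  let ?M = "Pi_pmf ({..<n} \<times> {..<n}) False (\<lambda>_. bernoulli_pmf p)"
  let ?E = "\<lambda>\<omega>. {{Inl a, Inr b} | a b. a < n \<and> b < n \<and> \<omega> (a, b)} :: (nat + nat) set set"
  let ?good = "{E. real (boxicity (bipartite_verts n) E) \<ge> \<delta> / 16 * (real n * p / ln n)}"
  define bad where "bad m v = {\<omega> :: nat \<times> nat \<Rightarrow> bool. \<exists>S T. S \<subseteq> {..<n} \<and> T \<subseteq> {..<n} \<and>
      card S = m \<and> card T = m \<and> (\<forall>x\<in>S \<times> T. \<omega> x = v)}" for m v
  have "exp (- c / n) \<le> 1"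
    using c by simp
  then have p1: "p \<le> 1"
    using p by linarith
  \<comment> \<open>Logarithms are at least 1 once \<open>n \<ge> 3 > e\<close>, which keeps
    \<open>s\<close> positive and absorbs its rounding.\<close>
  have "exp 1 \<le> real n"
    using e_less_272 n by linarith
  then have ln1: "1 \<le> ln (real n)"
    using n by (subst ln_ge_iff) auto
  have "3 * ln n / p \<le> s"
    unfolding s_def by linarith
  then have s_ge: "3 * ln n \<le> p * s"
    using p by (simp add: field_simps)
  then have s_pos: "0 < s"
    using ln1 by (cases s) auto
  \<comment> \<open>Rounding up adds less than 1, so at most one further
    \<open>ln n / p\<close>.\<close>
  have "1 \<le> ln n / p"
    using ln1 p p1 by (simp add: field_simps)
  then have s_le: "s \<le> 4 * ln n / p"
    unfolding s_def by linarith
  \<comment> \<open>Rounding down loses less than 1, which is at most half of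
    \<open>\<delta> * n\<close>.\<close>
  have t: "t \<le> \<delta> * n" "\<delta> * n / 2 \<le> t"
    unfolding t_def using n by linarith+
  have "?E \<omega> \<in> ?good" if "\<omega> \<notin> bad s False" "\<omega> \<notin> bad (n - t) True" for \<omega>
  proof -
    let ?k = "boxicity (bipartite_verts n) (?E \<omega>)"
    have "t < 2 * s * ?k"
      using that unfolding bad_def by (intro boxicity_bipartite_lower_bound) auto
    then have "real t \<le> real (2 * s * ?k)"
      by (intro of_nat_mono) simp
    also have "\<dots> = 2 * real s * ?k" by simp
    also have "\<dots> \<le> 2 * (4 * ln n / p) * ?k"
      using s_le by (intro mult_right_mono) auto
    finally have "\<delta> * n / 2 \<le> 2 * (4 * ln n / p) * ?k"
      using t by linarith
    then show ?thesis
      using p ln1 by (simp add: field_simps)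
  qed
  then have "UNIV - (bad s False \<union> bad (n - t) True) \<subseteq> ?E -` ?good"
    by blast
  then have "measure_pmf.prob ?M (UNIV - (bad s False \<union> bad (n - t) True))
      \<le> measure_pmf.prob ?M (?E -` ?good)"
    by (intro measure_pmf.finite_measure_mono) auto
  also have "\<dots> = measure_pmf.prob (random_bipartite n p) ?good"
    unfolding random_bipartite_def by simp
  also have "measure_pmf.prob ?M (UNIV - (bad s False \<union> bad (n - t) True))
      = 1 - measure_pmf.prob ?M (bad s False \<union> bad (n - t) True)"
    using measure_pmf.prob_compl[of "bad s False \<union> bad (n - t) True" ?M] by simp
  finally have good: "1 - measure_pmf.prob ?M (bad s False \<union> bad (n - t) True)
      \<le> measure_pmf.prob (random_bipartite n p) ?good" .
  have union: "measure_pmf.prob ?M (bad s False \<union> bad (n - t) True)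
      \<le> measure_pmf.prob ?M (bad s False) + measure_pmf.prob ?M (bad (n - t) True)"
    by (intro measure_Un_le) auto
  have empty: "measure_pmf.prob ?M (bad s False) \<le> 1 / n"
  proof -
    have "measure_pmf.prob ?M (bad s False) \<le> real (n choose s) ^ 2 * (1 - p) ^ (s * s)"
      unfolding bad_def
      using prob_constant_rectangle_le[of n False "bernoulli_pmf p" s False] p p1 by simp
    also have "\<dots> \<le> 1 / n"
      using n p p1 s_ge s_pos by (intro choose_sq_mult_power_le_empty) auto
    finally show ?thesis .
  qed
  have complete: "measure_pmf.prob ?M (bad (n - t) True) \<le> exp (- (c / 4) * n)"
  proof -
    have "measure_pmf.prob ?M (bad (n - t) True)
        \<le> real (n choose (n - t)) ^ 2 * p ^ ((n - t) * (n - t))"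
      unfolding bad_def
      using prob_constant_rectangle_le[of n False "bernoulli_pmf p" "n - t" True] p p1 by simp
    also have "\<dots> \<le> exp (- (c / 4) * n)"
      using n p c x \<delta> t by (intro choose_sq_mult_power_le_complete[where x = x and \<delta> = \<delta>]) auto
    finally show ?thesis .
  qed
  show ?thesis
    by (rule order_trans[OF diff_left_mono[OF order_trans[OF union add_mono[OF empty complete]]] good])
qed

text \<open>Both failure probabilities, at most \<open>1 / n\<close> and
  \<open>exp (- (c2 / 4) * n)\<close>, tend to 0, so it remains to choose the constants.\<close>

theorem theorem12:
  fixes c1 c2 :: real
  assumes "c1 > 4" and "c2 > 0"
  shows "\<exists>c>0. \<forall>p :: nat \<Rightarrow> real.
    (\<forall>\<^sub>F n in sequentially. c1 * (ln (real n) / real n) \<le> p n \<and> p n \<le> exp (- c2 / real n)) \<longrightarrow>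
    (\<lambda>n. measure_pmf.prob (random_bipartite n (p n))
           {E. real (boxicity (bipartite_verts n) E) \<ge> c * (real n * p n / ln (real n))})
      \<longlonglongrightarrow> 1"
proof -
  \<comment> \<open>\<open>x\<close> and \<open>\<delta>\<close> depend on \<open>c2\<close> alone,
    so the constant \<open>\<delta> / 16\<close> is fixed before \<open>p\<close>.\<close>
  define x where "x = min 1 (c2 / 16)"
  \<comment> \<open>The summand 1 keeps the denominator positive when \<open>x = 1\<close>.\<close>
  define \<delta> where "\<delta> = min (1 / 4) (c2 / 16 / (1 + ln (1 / x)))"
  have x: "0 < x" "x \<le> c2 / 16" "x \<le> 1"
    using assms by (auto simp: x_def)
  then have ln_x: "0 \<le> ln (1 / x)"
    by simp
  have \<delta>: "0 < \<delta>" "\<delta> \<le> 1 / 4"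
    unfolding \<delta>_def using assms ln_x by (simp_all only: min_less_iff_conj min.cobounded1) simp
  have "\<delta> \<le> c2 / 16 / (1 + ln (1 / x))"
    unfolding \<delta>_def by (rule min.cobounded2)
  moreover have "0 < 1 + ln (1 / x)"
    using ln_x by linarith
  ultimately have "\<delta> * (1 + ln (1 / x)) \<le> c2 / 16"
    using pos_le_divide_eq by blast
  then have \<delta>_ln: "\<delta> * ln (1 / x) \<le> c2 / 16"
    using \<delta>(1) unfolding distrib_left by linarith
  show ?thesis
  proof (intro exI[of _ "\<delta> / 16"] conjI allI impI)
    fix p :: "nat \<Rightarrow> real"
    let ?P = "\<lambda>n. measure_pmf.prob (random_bipartite n (p n))
      {E. real (boxicity (bipartite_verts n) E) \<ge> \<delta> / 16 * (real n * p n / ln (real n))}"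
    assume p: "\<forall>\<^sub>F n in sequentially. c1 * (ln (real n) / real n) \<le> p n \<and> p n \<le> exp (- c2 / real n)"
    have "\<forall>\<^sub>F n in sequentially. 1 - (1 / n + exp (- (c2 / 4) * n)) \<le> ?P n"
      using p eventually_ge_at_top[of 3] eventually_ge_at_top[of "nat \<lceil>2 / \<delta>\<rceil>"]
    proof eventually_elim
      case (elim n)
      have "2 / \<delta> \<le> n"
        using elim(3) by linarith
      then have "2 \<le> \<delta> * n"
        using \<delta> by (simp add: field_simps)
      moreover have "0 < c1 * (ln (real n) / real n)"
        using assms elim by (intro mult_pos_pos divide_pos_pos) auto
      then have "0 < p n"
        using elim by linarith
      ultimately show ?case
        using elim x \<delta> \<delta>_ln assms by (intro prob_boxicity_ge[where x = x]) auto
    qed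
    moreover have "(\<lambda>n. 1 - (1 / real n + exp (- (c2 / 4) * real n))) \<longlonglongrightarrow> 1"
      using assms by real_asymp
    ultimately show "?P \<longlonglongrightarrow> 1"
      by (intro tendsto_sandwich[where h = "\<lambda>_. 1" and g = ?P]) auto
  qed (use \<delta> in auto)
qed

end
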